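(* Let $\nu>-\frac12$ and suppose that $0<\gamma<\min\big\{\frac{1}{2(\nu+1)a_\nu},\frac{2\nu+1}{2(\nu+1)(1-a_\nu)}\big\}$. Then, for all $x>0$, $$\int_0^x \mathrm{e}^{-\gamma t}t^\nu I_\nu(t)\,\mathrm{d}t<\frac{2(\nu+1)}{(2\nu+1)(1-(1-a_\nu)\gamma)-(1-a_\nu)\gamma}\mathrm{e}^{-\gamma x}x^\nu I_{\nu+1}(x).$$
   Context: $I_\nu$ denotes the modified Bessel function of the first kind of real order $\nu$. For $\nu>-\frac{1}{2}$, $a_\nu$ denotes the largest number in the interval $[0,1]$ such that, for all $x>0$, $$I_{\nu+1}(x)<(1-a_\nu)I_\nu(x)+a_\nu I_{\nu+2}(x).$$ *)

theory Defs
  imports "HOL-Analysis.Analysis"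
begin

text \<open>
  Modified Bessel function of the first kind, for real order and positive real argument.
  Using \<^const>\<open>rGamma\<close> (the entire function $1/\Gamma$) makes the terms with
  $\nu + k + 1 \in \{0, -1, -2, \ldots\}$ vanish, as usual.
\<close>

definition bessel_I :: "real \<Rightarrow> real \<Rightarrow> real" where
  "bessel_I \<nu> x =
     (\<Sum>k. rGamma (\<nu> + real k + 1) / fact k * (x / 2) powr (\<nu> + 2 * real k))"

text \<open>
  The maximum exists for every $\nu > -1/2$: the inequality says
  $2(\nu+1)a < 2(\nu+1) - x\,(1 - I_{\nu+2}(x)/I_{\nu+1}(x))$, whose right-hand side stays
  strictly above its limit $\nu + 1/2$ at infinity.
\<close>

definition a_coeff :: "real \<Rightarrow> real" where
  "a_coeff \<nu> =
     (GREATEST a. a \<in> {0..1} \<and>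
        (\<forall>x>0. bessel_I (\<nu> + 1) x < (1 - a) * bessel_I \<nu> x + a * bessel_I (\<nu> + 2) x))"

end

theory Submission
  imports Defs
begin

text \<open>
  Differentiating \<open>exp (- \<gamma> t) t\<^sup>\<nu> I\<^bsub>\<nu>+1\<^esub>(t)\<close> and removing \<open>1 / t\<close> with the recurrence
  \<open>I\<^sub>\<nu> - I\<^bsub>\<nu>+2\<^esub> = (2(\<nu> + 1) / t) I\<^bsub>\<nu>+1\<^esub>\<close> gives
  \<open>exp (- \<gamma> t) t\<^sup>\<nu>\<close> times
  \<open>(2\<nu> + 1) / (2(\<nu> + 1)) I\<^sub>\<nu> + 1 / (2(\<nu> + 1)) I\<^bsub>\<nu>+2\<^esub> - \<gamma> I\<^bsub>\<nu>+1\<^esub>\<close>.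
  Write \<open>a\<close> for the optimal coefficient. Replacing \<open>I\<^bsub>\<nu>+1\<^esub>\<close> by its upper bound
  \<open>(1 - a) I\<^sub>\<nu> + a I\<^bsub>\<nu>+2\<^esub>\<close> leaves \<open>I\<^bsub>\<nu>+2\<^esub>\<close> with the coefficient
  \<open>1 / (2(\<nu> + 1)) - \<gamma> a\<close>, which the first bound on \<open>\<gamma>\<close> makes positive, and \<open>I\<^sub>\<nu>\<close>
  with \<open>(2\<nu> + 1) / (2(\<nu> + 1)) - \<gamma> (1 - a)\<close>, which the second bound makes positive; the
  latter is the reciprocal of the constant in the theorem. Dropping the \<open>I\<^bsub>\<nu>+2\<^esub>\<close> term and
  integrating from \<open>0\<close>, where \<open>t\<^sup>\<nu> I\<^bsub>\<nu>+1\<^esub>(t)\<close> vanishes because it is of order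
  \<open>t\<^bsup>2\<nu>+1\<^esup>\<close>, gives the claim.

  This uses that the greatest admissible coefficient exists. The lemma \<open>a_coeff_eq\<close>
  computes it: \<open>a = (2\<nu> + 1) / (4(\<nu> + 1))\<close>. By the recurrence, a coefficient \<open>a\<close> is
  admissible at \<open>x\<close> iff \<open>2(\<nu> + 1) a < h(x)\<close>, where \<open>h(x) = x (I\<^sub>\<nu>(x) / I\<^bsub>\<nu>+1\<^esub>(x) - 1)\<close>.
  This \<open>h\<close> solves the Riccati equation
  \<open>h' = 2(c - h) + h (2\<nu> + 2 - h) / x\<close> with \<open>c = \<nu> + 1 / 2\<close>. Its infimum is \<open>c\<close> and is not
  attained: \<open>h\<close> starts above \<open>c\<close> near \<open>0\<close> and could cross the level \<open>c\<close> only
  upwards (\<open>bessel_gap_greater\<close>), while staying above \<open>c + \<delta>\<close> would force \<open>h' \<le> - \<delta>\<close>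
  from some point on (\<open>bessel_gap_arbitrarily_close\<close>).
\<close>

section \<open>The Bessel-Clifford series\<close>

text \<open>
  The Bessel-Clifford function is the entire factor of \<open>I\<^sub>\<mu>\<close>:
  \<open>I\<^sub>\<mu>(x) = (x / 2)\<^sup>\<mu> C\<^sub>\<mu>(x\<^sup>2 / 4)\<close>. It is a genuine power series, so it can be differentiated
  term by term and is continuous at \<open>0\<close>.
\<close>

definition clifford :: "real \<Rightarrow> real \<Rightarrow> real" where
  "clifford \<mu> y = (\<Sum>k. rGamma (\<mu> + real k + 1) / fact k * y ^ k)"

lemma summable_clifford:
  fixes \<mu> y :: real
  shows "summable (\<lambda>k. rGamma (\<mu> + real k + 1) / fact k * y ^ k)"
proof -
  define N where "N = nat \<lceil>max (2 * \<bar>y\<bar>) (\<bar>\<mu>\<bar>)\<rceil>"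
  show ?thesis
  proof (rule summable_ratio_test[where c = "1/2" and N = N])
    fix k assume "N \<le> k"
    then have k: "2 * \<bar>y\<bar> \<le> real k" "\<bar>\<mu>\<bar> \<le> real k"
      unfolding N_def by linarith+
    \<comment> \<open>The choice of \<open>N\<close> puts the argument of \<open>rGamma\<close> beyond all its zeros, so that
      consecutive values of \<open>rGamma\<close> have a well-defined ratio.\<close>
    define q where "q = \<mu> + real k + 1"
    have q: "q \<ge> 1" using k by (simp add: q_def)
    have rg: "rGamma (q + 1) = rGamma q / q"
      using rGamma_plus1[of q] q by (simp add: field_simps)
    have "\<bar>y\<bar> / (q * (1 + real k)) \<le> 1 / 2"
    proof -
      have "2 * \<bar>y\<bar> \<le> 1 * (1 + real k)" using k by simp
      also have "\<dots> \<le> q * (1 + real k)" using q by (intro mult_right_mono) auto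
      finally have "\<bar>y\<bar> \<le> 1 / 2 * (q * (1 + real k))" by simp
      then show ?thesis using q by (subst pos_divide_le_eq) auto
    qed
    then have "\<bar>y\<bar> / (q * (1 + real k)) * norm (rGamma q / fact k * y ^ k)
        \<le> 1 / 2 * norm (rGamma q / fact k * y ^ k)"
      by (intro mult_right_mono) auto
    moreover have "norm (rGamma (q + 1) / fact (Suc k) * y ^ Suc k)
        = \<bar>y\<bar> / (q * (1 + real k)) * norm (rGamma q / fact k * y ^ k)"
      using q unfolding rg by (simp add: abs_mult field_simps)
    moreover have "\<mu> + real (Suc k) + 1 = q + 1" by (simp add: q_def)
    ultimately show "norm (rGamma (\<mu> + real (Suc k) + 1) / fact (Suc k) * y ^ Suc k)
        \<le> 1 / 2 * norm (rGamma (\<mu> + real k + 1) / fact k * y ^ k)"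
      by (simp only: q_def[symmetric])
  qed simp
qed

lemma clifford_has_derivative:
  "(clifford \<mu> has_real_derivative clifford (\<mu> + 1) y) (at y)"
proof -
  define c where "c k = rGamma (\<mu> + real k + 1) / fact k" for k
  have "((\<lambda>y. \<Sum>k. c k * y ^ k) has_real_derivative (\<Sum>k. diffs c k * y ^ k)) (at y)"
    unfolding c_def by (rule termdiffs_strong_converges_everywhere) (rule summable_clifford)
  moreover have "diffs c k = rGamma (\<mu> + 1 + real k + 1) / fact k" for k
    by (simp add: diffs_def c_def field_simps del: of_nat_Suc) (simp add: ac_simps)
  ultimately show ?thesis
    by (simp add: clifford_def[abs_def] c_def)
qed

lemma clifford_recurrence:
  "clifford \<mu> y - y * clifford (\<mu> + 2) y = (\<mu> + 1) * clifford (\<mu> + 1) y"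
proof -
  \<comment> \<open>Multiplication by \<open>y\<close> shifts the coefficients of \<open>C\<^bsub>\<mu>+2\<^esub>\<close> by one. The functional equation
    of \<open>rGamma\<close> then turns the difference of the coefficients of \<open>y ^ k\<close> into the factor
    \<open>(\<mu> + k + 1) - k = \<mu> + 1\<close>.\<close>
  define s where "s k = (case k of 0 \<Rightarrow> 0 | Suc j \<Rightarrow>
      y * (rGamma (\<mu> + 2 + real j + 1) / fact j * y ^ j))" for k
  have "(\<lambda>j. s (Suc j)) sums (y * clifford (\<mu> + 2) y)"
    unfolding s_def clifford_def nat.case
    by (intro sums_mult summable_sums summable_clifford)
  then have s: "s sums (y * clifford (\<mu> + 2) y)"
    by (subst (asm) sums_Suc_iff) (simp add: s_def)
  have "(\<lambda>k. rGamma (\<mu> + real k + 1) / fact k * y ^ k - s k)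
      sums (clifford \<mu> y - y * clifford (\<mu> + 2) y)"
    unfolding clifford_def[of \<mu>]
    by (intro sums_diff s summable_sums summable_clifford)
  moreover have "rGamma (\<mu> + real k + 1) / fact k * y ^ k - s k
      = (\<mu> + 1) * (rGamma (\<mu> + 1 + real k + 1) / fact k * y ^ k)" for k
  proof -
    have rg: "rGamma (\<mu> + real k + 1) = (\<mu> + real k + 1) * rGamma (\<mu> + 1 + real k + 1)"
      using rGamma_plus1[of "\<mu> + real k + 1"] by (simp add: ac_simps)
    show ?thesis
    proof (cases k)
      case 0
      then show ?thesis using rg by (simp add: s_def)
    next
      case (Suc j)
      have "s k = real k * rGamma (\<mu> + 1 + real k + 1) / fact k * y ^ k"
        by (simp add: s_def Suc del: of_nat_Suc) (simp add: ac_simps)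
      then show ?thesis unfolding rg by (simp add: field_simps)
    qed
  qed
  moreover have "(\<lambda>k. (\<mu> + 1) * (rGamma (\<mu> + 1 + real k + 1) / fact k * y ^ k))
      sums ((\<mu> + 1) * clifford (\<mu> + 1) y)"
    unfolding clifford_def
    by (intro sums_mult summable_sums summable_clifford)
  ultimately show ?thesis by (simp add: sums_unique2)
qed

lemma clifford_pos:
  assumes "\<mu> > -1" "y \<ge> 0"
  shows "clifford \<mu> y > 0"
proof -
  have rg: "rGamma (\<mu> + real k + 1) > 0" for k
    using assms by (simp add: rGamma_inverse_Gamma Gamma_real_pos)
  show ?thesis
    unfolding clifford_def
  proof (rule suminf_pos2[where i = 0])
    show "0 \<le> rGamma (\<mu> + real k + 1) / fact k * y ^ k" for k
      using assms less_imp_le[OF rg[of k]] by simp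
  qed (use rg[of 0] summable_clifford in auto)
qed

lemma continuous_on_clifford [continuous_intros]:
  "continuous_on S f \<Longrightarrow> continuous_on S (\<lambda>x. clifford \<mu> (f x))"
  by (rule continuous_on_compose2[where t = UNIV and g = "clifford \<mu>"])
     (auto intro!: DERIV_continuous_on[OF has_field_derivative_at_within[OF clifford_has_derivative]])

section \<open>Recurrence and derivatives of the modified Bessel functions\<close>

lemma bessel_I_eq_clifford:
  assumes "x > 0"
  shows "bessel_I \<mu> x = (x / 2) powr \<mu> * clifford \<mu> ((x / 2)\<^sup>2)"
proof -
  have "(x / 2) powr (\<mu> + 2 * real k) = (x / 2) powr \<mu> * ((x / 2)\<^sup>2) ^ k" for k
    using assms powr_realpow[of "x / 2" "2 * k"]
    by (simp add: powr_add power_mult)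
  then show ?thesis
    unfolding bessel_I_def clifford_def
    using suminf_mult[OF summable_clifford, of "(x / 2) powr \<mu>" \<mu> "(x / 2)\<^sup>2"]
    by (simp add: mult_ac)
qed

lemma bessel_I_pos:
  assumes "\<mu> > -1" "x > 0"
  shows "bessel_I \<mu> x > 0"
  using assms by (simp add: bessel_I_eq_clifford clifford_pos)

lemma bessel_I_recurrence:
  assumes "x > 0"
  shows "x * (bessel_I \<mu> x - bessel_I (\<mu> + 2) x) = 2 * (\<mu> + 1) * bessel_I (\<mu> + 1) x"
proof -
  have e: "bessel_I \<mu> x = (x / 2) powr \<mu> * clifford \<mu> ((x / 2)\<^sup>2)"
    "bessel_I (\<mu> + 1) x = (x / 2) powr \<mu> * ((x / 2) * clifford (\<mu> + 1) ((x / 2)\<^sup>2))"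
    "bessel_I (\<mu> + 2) x = (x / 2) powr \<mu> * ((x / 2)\<^sup>2 * clifford (\<mu> + 2) ((x / 2)\<^sup>2))"
    using assms powr_realpow[of "x/2" 2]
    by (simp_all add: bessel_I_eq_clifford powr_add)
  have "x * (bessel_I \<mu> x - bessel_I (\<mu> + 2) x)
     = x * (x / 2) powr \<mu> * (clifford \<mu> ((x / 2)\<^sup>2) - (x / 2)\<^sup>2 * clifford (\<mu> + 2) ((x / 2)\<^sup>2))"
    unfolding e by (simp only: right_diff_distrib mult_ac)
  also have "\<dots> = 2 * (\<mu> + 1) * ((x / 2) powr \<mu> * ((x / 2) * clifford (\<mu> + 1) ((x / 2)\<^sup>2)))"
    unfolding clifford_recurrence by simp
  also have "\<dots> = 2 * (\<mu> + 1) * bessel_I (\<mu> + 1) x"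
    unfolding e ..
  finally show ?thesis .
qed

lemma bessel_I_has_derivative_up:
  assumes x: "x > 0"
  shows "(bessel_I \<mu> has_real_derivative \<mu> / x * bessel_I \<mu> x + bessel_I (\<mu> + 1) x) (at x)"
proof -
  have "((\<lambda>x. (x / 2) powr \<mu> * clifford \<mu> ((x / 2)\<^sup>2)) has_real_derivative
      \<mu> / x * ((x / 2) powr \<mu> * clifford \<mu> ((x / 2)\<^sup>2))
      + (x / 2) powr (\<mu> + 1) * clifford (\<mu> + 1) ((x / 2)\<^sup>2)) (at x)"
    using x by (auto intro!: derivative_eq_intros DERIV_chain2[OF clifford_has_derivative]
                simp: powr_diff powr_add field_simps power2_eq_square)
  then show ?thesis
    unfolding bessel_I_eq_clifford[OF x]
    by (rule has_field_derivative_transform_within_open[where S = "{0<..}"])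
       (use x in \<open>auto simp: bessel_I_eq_clifford\<close>)
qed

lemma bessel_I_has_derivative_down:
  assumes x: "x > 0"
  shows "(bessel_I (\<mu> + 1) has_real_derivative
           bessel_I \<mu> x - (\<mu> + 1) / x * bessel_I (\<mu> + 1) x) (at x)"
  using bessel_I_has_derivative_up[OF x, of "\<mu> + 1"] bessel_I_recurrence[OF x, of \<mu>] x
  by (simp add: field_simps)

section \<open>The Riccati equation and the optimal coefficient\<close>

text \<open>
  The ratio \<open>I\<^sub>\<nu> / I\<^bsub>\<nu>+1\<^esub>\<close> approaches its limit \<open>1\<close> at infinity at the rate \<open>1 / x\<close>.
  The factor \<open>x\<close> compensates for this rate: the product tends to \<open>\<nu> + 1 / 2\<close>.
\<close>

definition bessel_gap :: "real \<Rightarrow> real \<Rightarrow> real" where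
  "bessel_gap \<nu> x = x * (bessel_I \<nu> x / bessel_I (\<nu> + 1) x - 1)"

lemma bessel_gap_has_derivative:
  assumes \<nu>: "\<nu> > -1" and x: "x > 0"
  shows "(bessel_gap \<nu> has_real_derivative
           2 * (\<nu> + 1 / 2 - bessel_gap \<nu> x)
           + bessel_gap \<nu> x * (2 * \<nu> + 2 - bessel_gap \<nu> x) / x) (at x)"
proof -
  define p q where "p = bessel_I \<nu> x" and "q = bessel_I (\<nu> + 1) x"
  have q: "q > 0" using \<nu> x by (simp add: q_def bessel_I_pos)
  have "(bessel_gap \<nu> has_real_derivative
      (p / q - 1) + ((\<nu> / x * p + q) * q - p * (p - (\<nu> + 1) / x * q)) / (q * q) * x) (at x)"
    unfolding bessel_gap_def[abs_def] p_def q_def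
    using x q by (auto intro!: derivative_eq_intros bessel_I_has_derivative_up[OF x, of \<nu>]
        bessel_I_has_derivative_down[OF x, of \<nu>] simp: q_def)
  moreover have "(p / q - 1) + ((\<nu> / x * p + q) * q - p * (p - (\<nu> + 1) / x * q)) / (q * q) * x
      = 2 * (\<nu> + 1 / 2 - x * (p / q - 1))
           + x * (p / q - 1) * (2 * \<nu> + 2 - x * (p / q - 1)) / x"
  proof -
    define r where "r = p / q"
    have p: "p = r * q" using q by (simp add: r_def)
    show ?thesis unfolding p using x q by (simp add: field_simps)
  qed
  ultimately show ?thesis by (simp only: bessel_gap_def[of \<nu> x] p_def q_def)
qed

lemma bessel_gap_near_0:
  assumes "\<nu> > -1" "x > 0"
  shows "bessel_gap \<nu> x > 2 * (\<nu> + 1) - x"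
proof -
  have "bessel_I (\<nu> + 1) x > 0" "bessel_I (\<nu> + 2) x > 0"
    using assms by (simp_all add: bessel_I_pos)
  moreover have "x * bessel_I \<nu> x = 2 * (\<nu> + 1) * bessel_I (\<nu> + 1) x + x * bessel_I (\<nu> + 2) x"
    using bessel_I_recurrence[of x \<nu>] assms by (simp add: algebra_simps)
  then have "bessel_gap \<nu> x = (2 * (\<nu> + 1) * bessel_I (\<nu> + 1) x + x * bessel_I (\<nu> + 2) x)
      / bessel_I (\<nu> + 1) x - x"
    by (simp add: bessel_gap_def right_diff_distrib)
  ultimately show ?thesis using assms by (simp add: add_divide_distrib)
qed

text \<open>
  At a first point \<open>z\<close> where the gap equals \<open>c = \<nu> + 1 / 2\<close>, the Riccati equation gives the
  positive slope \<open>c (c + 1) / z\<close>, so the gap would have been below \<open>c\<close> just before \<open>z\<close>.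
\<close>

lemma bessel_gap_greater:
  assumes \<nu>: "\<nu> > - 1 / 2" and x: "x > 0"
  shows "bessel_gap \<nu> x > \<nu> + 1 / 2"
proof (rule ccontr)
  assume neg: "\<not> ?thesis"
  define c where "c = \<nu> + 1 / 2"
  \<comment> \<open>Up to \<open>\<nu> + 1\<close> the bound \<open>2 * (\<nu> + 1) - x\<close> near \<open>0\<close> already exceeds \<open>c\<close>.\<close>
  define e where "e = min x (\<nu> + 1)"
  define A where "A = {t \<in> {e..x}. bessel_gap \<nu> t \<le> c}"
  have e: "0 < e" "e \<le> x" using \<nu> x by (auto simp: e_def)
  have he: "bessel_gap \<nu> e > c"
    using bessel_gap_near_0[of \<nu> e] \<nu> e by (simp add: e_def c_def)
  have cont: "isCont (bessel_gap \<nu>) t" if "t > 0" for t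
    using bessel_gap_has_derivative[of \<nu> t] \<nu> that by (intro DERIV_isCont) auto
  have "closed A"
    unfolding A_def
    by (intro continuous_on_closed_Collect_le continuous_intros continuous_at_imp_continuous_on)
       (use e cont in auto)
  moreover have "A \<noteq> {}" "bdd_below A"
    using neg e by (auto simp: A_def c_def intro!: bdd_belowI[of _ e])
  ultimately have z: "Inf A \<in> A" by (intro closed_contains_Inf)
  define z where "z = Inf A"
  have z1: "e \<le> z" "z \<le> x" "bessel_gap \<nu> z \<le> c"
    using z by (auto simp: A_def z_def)
  have ze: "e < z" using z1 he by (cases "z = e") auto
  have before: "bessel_gap \<nu> t > c" if "e \<le> t" "t < z" for t
  proof (rule ccontr)
    assume "\<not> ?thesis"
    then have "t \<in> A" using that z1 by (auto simp: A_def)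
    then have "z \<le> t" unfolding z_def using \<open>bdd_below A\<close> by (rule cInf_lower)
    then show False using that by simp
  qed
  have "bessel_gap \<nu> z = c"
  proof (rule antisym[OF z1(3)], rule tendsto_lowerbound)
    show "(bessel_gap \<nu> \<longlongrightarrow> bessel_gap \<nu> z) (at_left z)"
      using cont[of z] ze e by (auto simp: isCont_def intro: filterlim_mono at_le)
    show "\<forall>\<^sub>F t in at_left z. c \<le> bessel_gap \<nu> t"
      using eventually_at_left_real[OF ze] by eventually_elim (auto intro!: less_imp_le before)
  qed simp
  then have "(bessel_gap \<nu> has_real_derivative c * (c + 1) / z) (at z)"
    using bessel_gap_has_derivative[of \<nu> z] \<nu> ze e by (simp add: c_def algebra_simps)
  moreover have "c * (c + 1) / z > 0" using \<nu> ze e by (simp add: c_def)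
  ultimately obtain d where d: "d > 0" "\<And>h. 0 < h \<Longrightarrow> h < d \<Longrightarrow> bessel_gap \<nu> (z - h) < bessel_gap \<nu> z"
    by (metis DERIV_pos_inc_left)
  define h where "h = min (d / 2) (z - e)"
  have "0 < h" "h < d" "h \<le> z - e" using d ze by (auto simp: h_def)
  then show False
    using d(2)[of h] before[of "z - h"] \<open>bessel_gap \<nu> z = c\<close> by auto
qed

text \<open>
  If the gap stayed above \<open>\<nu> + 1 / 2 + \<delta>\<close>, the Riccati equation would bound its derivative by
  \<open>- 2 \<delta> + (\<nu> + 1)\<^sup>2 / x\<close>, hence by \<open>- \<delta>\<close> for \<open>x \<ge> (\<nu> + 1)\<^sup>2 / \<delta>\<close>, and it would
  reach \<open>0\<close>.
\<close>

lemma bessel_gap_arbitrarily_close: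
  assumes \<nu>: "\<nu> > - 1 / 2" and \<delta>: "\<delta> > 0"
  obtains x where "x > 0" "bessel_gap \<nu> x < \<nu> + 1 / 2 + \<delta>"
proof (rule ccontr)
  assume "\<not> thesis"
  then have ge: "bessel_gap \<nu> x \<ge> \<nu> + 1 / 2 + \<delta>" if "x > 0" for x
    using that \<open>\<And>x. x > 0 \<Longrightarrow> bessel_gap \<nu> x < \<nu> + 1 / 2 + \<delta> \<Longrightarrow> thesis\<close> by force
  define X where "X = (\<nu> + 1)\<^sup>2 / \<delta>"
  have X: "X > 0" using \<nu> \<delta> by (simp add: X_def)
  have gX: "bessel_gap \<nu> X > 0" using ge[OF X] \<nu> \<delta> by linarith
  define L where "L = bessel_gap \<nu> X / \<delta>"
  have "bessel_gap \<nu> (X + L) + \<delta> * (X + L) \<le> bessel_gap \<nu> X + \<delta> * X"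
  proof (rule DERIV_nonpos_imp_nonincreasing[where f = "\<lambda>t. bessel_gap \<nu> t + \<delta> * t"])
    fix t assume t: "X \<le> t" "t \<le> X + L"
    let ?h = "bessel_gap \<nu> t"
    have t0: "t > 0" using t X by simp
    have "?h * (2 * \<nu> + 2 - ?h) \<le> (\<nu> + 1)\<^sup>2"
      using zero_le_power2[of "?h - (\<nu> + 1)"] by (simp add: power2_eq_square algebra_simps)
    also have "\<dots> = \<delta> * X" using \<delta> by (simp add: X_def)
    also have "\<dots> \<le> \<delta> * t" using t \<delta> by simp
    finally have "?h * (2 * \<nu> + 2 - ?h) / t \<le> \<delta>" using t0 by (simp add: pos_divide_le_eq)
    then have "2 * (\<nu> + 1 / 2 - ?h) + ?h * (2 * \<nu> + 2 - ?h) / t + \<delta> \<le> 0"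
      using ge[OF t0] by (simp add: algebra_simps)
    moreover have "((\<lambda>t. bessel_gap \<nu> t + \<delta> * t) has_real_derivative
        2 * (\<nu> + 1 / 2 - ?h) + ?h * (2 * \<nu> + 2 - ?h) / t + \<delta>) (at t)"
      using \<nu> t0 by (auto intro!: derivative_eq_intros bessel_gap_has_derivative)
    ultimately show "\<exists>y. ((\<lambda>t. bessel_gap \<nu> t + \<delta> * t) has_real_derivative y) (at t) \<and> y \<le> 0"
      by blast
  qed (use gX \<delta> in \<open>simp add: L_def\<close>)
  then have "bessel_gap \<nu> (X + L) \<le> 0" using \<delta> by (simp add: L_def algebra_simps)
  moreover have "X + L > 0" using X gX \<delta> by (simp add: L_def add_pos_pos)
  ultimately show False using ge[of "X + L"] \<nu> \<delta> by linarith
qed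

lemma bessel_interpolation_iff:
  assumes \<nu>: "\<nu> > -1" and x: "x > 0"
  shows "bessel_I (\<nu> + 1) x < (1 - a) * bessel_I \<nu> x + a * bessel_I (\<nu> + 2) x
    \<longleftrightarrow> 2 * (\<nu> + 1) * a < bessel_gap \<nu> x"
proof -
  define q where "q = bessel_I (\<nu> + 1) x"
  define D where "D = (1 - a) * bessel_I \<nu> x + a * bessel_I (\<nu> + 2) x - q"
  have q: "q > 0" using \<nu> x by (simp add: q_def bessel_I_pos)
  have "x * D = x * (bessel_I \<nu> x - q) - a * (x * (bessel_I \<nu> x - bessel_I (\<nu> + 2) x))"
    by (simp add: D_def algebra_simps)
  also have "\<dots> = q * (bessel_gap \<nu> x - 2 * (\<nu> + 1) * a)"
    unfolding bessel_I_recurrence[OF x] bessel_gap_def q_def[symmetric] using q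
    by (simp add: field_simps)
  finally have "0 < D \<longleftrightarrow> 0 < bessel_gap \<nu> x - 2 * (\<nu> + 1) * a"
    using q x by (metis zero_less_mult_pos mult_pos_pos)
  then show ?thesis by (auto simp: D_def q_def)
qed

lemma bessel_interpolation:
  assumes \<nu>: "\<nu> > - 1 / 2" and x: "x > 0" and a: "a = (2 * \<nu> + 1) / (4 * (\<nu> + 1))"
  shows "bessel_I (\<nu> + 1) x < (1 - a) * bessel_I \<nu> x + a * bessel_I (\<nu> + 2) x"
proof -
  have "2 * (\<nu> + 1) * a = \<nu> + 1 / 2"
    using \<nu> by (simp add: a field_simps)
  then show ?thesis
    using bessel_interpolation_iff[of \<nu> x a] bessel_gap_greater[OF \<nu> x] \<nu> x by simp
qed

text \<open>
  The coefficient is the infimum \<open>\<nu> + 1 / 2\<close> of the gap divided by \<open>2 * (\<nu> + 1)\<close>. The gap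
  does not attain its infimum, so the strict inequality still holds for this coefficient and it is
  a maximum.
\<close>

lemma a_coeff_eq:
  assumes \<nu>: "\<nu> > - 1 / 2"
  shows "a_coeff \<nu> = (2 * \<nu> + 1) / (4 * (\<nu> + 1))"
  unfolding a_coeff_def
proof (rule Greatest_equality)
  have "(2 * \<nu> + 1) / (4 * (\<nu> + 1)) \<in> {0..1}"
    using \<nu> by (simp add: field_simps)
  then show "(2 * \<nu> + 1) / (4 * (\<nu> + 1)) \<in> {0..1} \<and>
    (\<forall>x>0. bessel_I (\<nu> + 1) x < (1 - (2 * \<nu> + 1) / (4 * (\<nu> + 1))) * bessel_I \<nu> x
        + (2 * \<nu> + 1) / (4 * (\<nu> + 1)) * bessel_I (\<nu> + 2) x)"
    using bessel_interpolation[OF \<nu> _ refl] by blast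
next
  fix a assume a: "a \<in> {0..1} \<and>
    (\<forall>x>0. bessel_I (\<nu> + 1) x < (1 - a) * bessel_I \<nu> x + a * bessel_I (\<nu> + 2) x)"
  have "2 * (\<nu> + 1) * a \<le> \<nu> + 1 / 2"
  proof (rule field_le_epsilon)
    fix \<delta> :: real assume "\<delta> > 0"
    then obtain x where "x > 0" "bessel_gap \<nu> x < \<nu> + 1 / 2 + \<delta>"
      using bessel_gap_arbitrarily_close[OF \<nu>] by blast
    then show "2 * (\<nu> + 1) * a \<le> \<nu> + 1 / 2 + \<delta>"
      using a \<nu> bessel_interpolation_iff[of \<nu> x a] by force
  qed
  then show "a \<le> (2 * \<nu> + 1) / (4 * (\<nu> + 1))"
    using \<nu> by (simp add: field_simps)
qed

section \<open>The integral inequality\<close>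

text \<open>
  Continuity includes the endpoint \<open>0\<close>, where the convention
  \<open>0 powr p = 0\<close> gives the value \<open>0\<close>: the product is \<open>O(t\<^bsup>\<nu>+\<mu>\<^esup>)\<close> and the exponent is positive.
\<close>

lemma continuous_on_powr_bessel_I:
  assumes "\<nu> + \<mu> > 0"
  shows "continuous_on {0..} (\<lambda>t. t powr \<nu> * bessel_I \<mu> t)"
proof -
  have "continuous_on {0..} (\<lambda>t. t powr (\<nu> + \<mu>) / 2 powr \<mu> * clifford \<mu> ((t / 2)\<^sup>2))"
    using assms by (intro continuous_intros continuous_on_powr') auto
  moreover have "t powr (\<nu> + \<mu>) / 2 powr \<mu> * clifford \<mu> ((t / 2)\<^sup>2) = t powr \<nu> * bessel_I \<mu> t"
    if "t \<in> {0..}" for t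
    using that by (cases "t = 0") (auto simp: bessel_I_eq_clifford powr_add powr_divide)
  ultimately show ?thesis by (subst continuous_on_cong[OF refl, symmetric]) auto
qed

lemma exp_powr_bessel_I_has_derivative:
  assumes \<nu>: "\<nu> > - 1" and t: "t > 0"
  shows "((\<lambda>t. exp (- \<gamma> * t) * (t powr \<nu> * bessel_I (\<nu> + 1) t)) has_real_derivative
     exp (- \<gamma> * t) * t powr \<nu> * ((2 * \<nu> + 1) / (2 * (\<nu> + 1)) * bessel_I \<nu> t
       + 1 / (2 * (\<nu> + 1)) * bessel_I (\<nu> + 2) t - \<gamma> * bessel_I (\<nu> + 1) t)) (at t)"
proof -
  define p q r where "p = bessel_I \<nu> t" and "q = bessel_I (\<nu> + 1) t" and "r = bessel_I (\<nu> + 2) t"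
  have rec: "q = t * (p - r) / (2 * (\<nu> + 1))"
    using bessel_I_recurrence[OF t, of \<nu>] \<nu> by (simp add: p_def q_def r_def field_simps)
  define B where "B = bessel_I (\<nu> + 1)"
  have B: "(B has_real_derivative p - (\<nu> + 1) / t * q) (at t)" "q = B t"
    unfolding B_def p_def q_def by (rule bessel_I_has_derivative_down[OF t] refl)+
  have "((\<lambda>t. exp (- \<gamma> * t) * (t powr \<nu> * B t)) has_real_derivative
     exp (- \<gamma> * t) * t powr \<nu> * (\<nu> / t * q + (p - (\<nu> + 1) / t * q) - \<gamma> * q)) (at t)"
    using t by (auto intro!: derivative_eq_intros B(1) simp: B(2) powr_diff field_simps)
  moreover have "\<nu> / t * q + (p - (\<nu> + 1) / t * q)
      = (2 * \<nu> + 1) / (2 * (\<nu> + 1)) * p + 1 / (2 * (\<nu> + 1)) * r"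
    unfolding rec using t \<nu> by (simp add: divide_simps) (simp add: algebra_simps)
  ultimately show ?thesis by (simp only: p_def q_def r_def B_def)
qed

lemma exp_powr_bessel_I_integral:
  assumes \<nu>: "\<nu> > - 1 / 2" and x: "x \<ge> 0"
  shows "((\<lambda>t. exp (- \<gamma> * t) * t powr \<nu> * ((2 * \<nu> + 1) / (2 * (\<nu> + 1)) * bessel_I \<nu> t
       + 1 / (2 * (\<nu> + 1)) * bessel_I (\<nu> + 2) t - \<gamma> * bessel_I (\<nu> + 1) t))
     has_integral exp (- \<gamma> * x) * (x powr \<nu> * bessel_I (\<nu> + 1) x)) {0..x}"
proof -
  have "continuous_on {0..x} (\<lambda>t. exp (- \<gamma> * t) * (t powr \<nu> * bessel_I (\<nu> + 1) t))"
    by (intro continuous_intros continuous_on_subset[OF continuous_on_powr_bessel_I]) (use \<nu> in auto)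
  from fundamental_theorem_of_calculus_interior[OF x this]
    exp_powr_bessel_I_has_derivative[of \<nu> _ \<gamma>] show ?thesis
    using \<nu> by (simp add: has_real_derivative_iff_has_vector_derivative)
qed

text \<open>
  The integrand behaves like \<open>t\<^bsup>2\<nu>\<^esup>\<close> at \<open>0\<close> and may be unbounded there. It is nevertheless a
  linear combination of the derivative integrated above and of terms with \<open>I\<^bsub>\<nu>+1\<^esub>\<close> and
  \<open>I\<^bsub>\<nu>+2\<^esub>\<close>, which are continuous up to \<open>0\<close>.
\<close>

lemma exp_powr_bessel_I_integrable:
  assumes \<nu>: "\<nu> > - 1 / 2" and x: "x \<ge> 0"
  shows "(\<lambda>t. exp (- \<gamma> * t) * t powr \<nu> * bessel_I \<nu> t) integrable_on {0..x}"
proof -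
  define \<alpha> \<beta> where "\<alpha> = (2 * \<nu> + 1) / (2 * (\<nu> + 1))" and "\<beta> = 1 / (2 * (\<nu> + 1))"
  have \<alpha>: "\<alpha> > 0" using \<nu> by (simp add: \<alpha>_def)
  let ?E = "\<lambda>\<mu> t. exp (- \<gamma> * t) * (t powr \<nu> * bessel_I \<mu> t)"
  have int: "?E \<mu> integrable_on {0..x}" if "\<nu> + \<mu> > 0" for \<mu>
    by (intro integrable_continuous_real continuous_intros
        continuous_on_subset[OF continuous_on_powr_bessel_I]) (use that in auto)
  have "(\<lambda>t. exp (- \<gamma> * t) * t powr \<nu> *
      (\<alpha> * bessel_I \<nu> t + \<beta> * bessel_I (\<nu> + 2) t - \<gamma> * bessel_I (\<nu> + 1) t)) integrable_on {0..x}"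
    unfolding \<alpha>_def \<beta>_def using exp_powr_bessel_I_integral[OF assms] by blast
  from integrable_cmul[OF integrable_add[OF integrable_diff[OF this
      integrable_cmul[OF int[of "\<nu> + 2"], of \<beta>]] integrable_cmul[OF int[of "\<nu> + 1"], of \<gamma>]],
      of "1 / \<alpha>"]
  show ?thesis
    using \<nu> \<alpha> by (simp add: field_simps)
qed

theorem theorem2p7:
  fixes \<nu> \<gamma> :: real
  assumes "\<nu> > - 1 / 2"
    and "0 < \<gamma>"
    and "\<gamma> < min (1 / (2 * (\<nu> + 1) * a_coeff \<nu>))
                 ((2 * \<nu> + 1) / (2 * (\<nu> + 1) * (1 - a_coeff \<nu>)))"
  shows "\<forall>x>0. integral {0..x} (\<lambda>t. exp (- \<gamma> * t) * t powr \<nu> * bessel_I \<nu> t)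
           < 2 * (\<nu> + 1) /
               ((2 * \<nu> + 1) * (1 - (1 - a_coeff \<nu>) * \<gamma>) - (1 - a_coeff \<nu>) * \<gamma>)
             * exp (- \<gamma> * x) * x powr \<nu> * bessel_I (\<nu> + 1) x"
proof (intro allI impI)
  fix x :: real assume x: "x > 0"
  note \<nu> = assms(1)
  define a where "a = a_coeff \<nu>"
  define D where "D = (2 * \<nu> + 1) * (1 - (1 - a) * \<gamma>) - (1 - a) * \<gamma>"
  define \<kappa> where "\<kappa> = D / (2 * (\<nu> + 1))"
  let ?f = "\<lambda>t. exp (- \<gamma> * t) * t powr \<nu> * bessel_I \<nu> t"
  let ?g = "\<lambda>t. exp (- \<gamma> * t) * t powr \<nu> * ((2 * \<nu> + 1) / (2 * (\<nu> + 1)) * bessel_I \<nu> t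
       + 1 / (2 * (\<nu> + 1)) * bessel_I (\<nu> + 2) t - \<gamma> * bessel_I (\<nu> + 1) t)"
  have a_eq: "a = (2 * \<nu> + 1) / (4 * (\<nu> + 1))" unfolding a_def by (rule a_coeff_eq[OF \<nu>])
  have a: "0 < a" "a < 1" using \<nu> by (simp_all add: a_eq)
  have \<gamma>1: "\<gamma> * a < 1 / (2 * (\<nu> + 1))" and \<gamma>2: "\<gamma> * (1 - a) < (2 * \<nu> + 1) / (2 * (\<nu> + 1))"
    using assms(3) \<nu> a pos_less_divide_eq[of "2 * (\<nu> + 1) * a" \<gamma> 1]
      pos_less_divide_eq[of "2 * (\<nu> + 1) * (1 - a)" \<gamma> "2 * \<nu> + 1"]
    unfolding a_def[symmetric] by (simp_all add: pos_less_divide_eq mult_ac)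
  have \<kappa>_eq: "\<kappa> = (2 * \<nu> + 1) / (2 * (\<nu> + 1)) - \<gamma> * (1 - a)"
    using \<nu> by (simp add: \<kappa>_def D_def divide_simps) (simp add: algebra_simps)
  have \<kappa>: "\<kappa> > 0" using \<gamma>2 by (simp add: \<kappa>_eq)
  have less: "\<kappa> * ?f t < ?g t" if t: "t > 0" for t
  proof -
    have "bessel_I (\<nu> + 1) t < (1 - a) * bessel_I \<nu> t + a * bessel_I (\<nu> + 2) t"
      by (rule bessel_interpolation[OF \<nu> t a_eq])
    then have "\<gamma> * bessel_I (\<nu> + 1) t < \<gamma> * ((1 - a) * bessel_I \<nu> t + a * bessel_I (\<nu> + 2) t)"
      using assms(2) by simp
    moreover have "\<gamma> * a * bessel_I (\<nu> + 2) t < 1 / (2 * (\<nu> + 1)) * bessel_I (\<nu> + 2) t"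
      using \<gamma>1 bessel_I_pos[of "\<nu> + 2" t] \<nu> t by (intro mult_strict_right_mono) auto
    ultimately have "\<kappa> * bessel_I \<nu> t < (2 * \<nu> + 1) / (2 * (\<nu> + 1)) * bessel_I \<nu> t
       + 1 / (2 * (\<nu> + 1)) * bessel_I (\<nu> + 2) t - \<gamma> * bessel_I (\<nu> + 1) t"
      unfolding \<kappa>_eq by (simp add: algebra_simps)
    then have "exp (- \<gamma> * t) * t powr \<nu> * (\<kappa> * bessel_I \<nu> t) < ?g t"
      using t by (intro mult_strict_left_mono) auto
    then show ?thesis by (simp only: mult_ac)
  qed
  have f_int: "(\<lambda>t. \<kappa> * ?f t) integrable_on {0..x}"
    using integrable_cmul[OF exp_powr_bessel_I_integrable[of \<nu> x \<gamma>], of \<kappa>] \<nu> x by simp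
  have g_int: "(?g has_integral exp (- \<gamma> * x) * (x powr \<nu> * bessel_I (\<nu> + 1) x)) {0..x}"
    using exp_powr_bessel_I_integral[of \<nu> x \<gamma>] \<nu> x by simp
  have g_integrable: "?g integrable_on {0..x}" using g_int by blast
  \<comment> \<open>The integrands may be singular at \<open>0\<close>, so the integrals are compared weakly on the left
    half, and strictly on the right half, where both integrands are continuous.\<close>
  have "integral {0..x/2} (\<lambda>t. \<kappa> * ?f t) \<le> integral {0..x/2} ?g"
  proof (rule integral_le)
    show "\<kappa> * ?f t \<le> ?g t" if "t \<in> {0..x/2}" for t
      using less[of t] that by (cases "t = 0") auto
  qed (rule integrable_subinterval_real[OF f_int] integrable_subinterval_real[OF g_integrable]; use x in auto)+
  moreover have "integral {x/2..x} (\<lambda>t. \<kappa> * ?f t) < integral {x/2..x} ?g"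
  proof (rule integral_less_real)
    have "continuous_on {x/2..x} (bessel_I \<mu>)" for \<mu>
      using x by (intro continuous_at_imp_continuous_on ballI DERIV_isCont[OF bessel_I_has_derivative_up]) auto
    then show "continuous_on {x/2..x} (\<lambda>t. \<kappa> * ?f t)" "continuous_on {x/2..x} ?g"
      using x \<nu> by (auto intro!: continuous_intros)
  qed (use x less in auto)
  ultimately have "integral {0..x} (\<lambda>t. \<kappa> * ?f t) < integral {0..x} ?g"
    using Henstock_Kurzweil_Integration.integral_combine[OF _ _ f_int, of "x/2"]
      Henstock_Kurzweil_Integration.integral_combine[OF _ _ g_integrable, of "x/2"] x
    by simp
  then have "\<kappa> * integral {0..x} ?f < exp (- \<gamma> * x) * (x powr \<nu> * bessel_I (\<nu> + 1) x)"
    using integral_unique[OF g_int] by simp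
  then have "integral {0..x} ?f < 1 / \<kappa> * (exp (- \<gamma> * x) * (x powr \<nu> * bessel_I (\<nu> + 1) x))"
    using \<kappa> by (simp add: field_simps)
  also have "\<dots> = 2 * (\<nu> + 1) / D * exp (- \<gamma> * x) * x powr \<nu> * bessel_I (\<nu> + 1) x"
    by (simp add: \<kappa>_def)
  finally show "integral {0..x} ?f < 2 * (\<nu> + 1) /
               ((2 * \<nu> + 1) * (1 - (1 - a_coeff \<nu>) * \<gamma>) - (1 - a_coeff \<nu>) * \<gamma>)
             * exp (- \<gamma> * x) * x powr \<nu> * bessel_I (\<nu> + 1) x"
    unfolding D_def a_def .
qed

end
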